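(* Let $n\ge1$. Let $f\in\ell^2(\mathbb{Z}^n)$ with $f\ne0$ and let $g\in\ell^2(\mathbb{Z}^n)$ be a non-zero window function. Let $\Sigma=Z\times T\subset\mathbb{Z}^n\times\mathbb{T}^n$, where $Z\subset\mathbb{Z}^n$ is arbitrary and $T\subset\mathbb{T}^n$ is measurable, and let $\varepsilon\ge0$ be such that $$\sum_{m\in Z}\int_T|V_gf(m,w)|^2\,d\mu(w)\ge(1-\varepsilon)\,\|f\|_{\ell^2(\mathbb{Z}^n)}^2\,\|g\|_{\ell^2(\mathbb{Z}^n)}^2.$$ Then $(\nu\otimes\mu)(\Sigma)\ge1-\varepsilon$.
   Context: For $f,g\in\ell^2(\mathbb{Z}^n)$ the short-time Fourier transform (STFT) of $f$ with window $g$ is the function on $\mathbb{Z}^n\times\mathbb{T}^n$ (where $\mathbb{T}^n=\mathbb{R}^n/\mathbb{Z}^n$) given by $V_gf(m,w)=\sum_{k\in\mathbb{Z}^n}f(k)\,\overline{g(k-m)}\,e^{-2\pi i w\cdot k}$. The measure $\nu\otimes\mu$ on $\mathbb{Z}^n\times\mathbb{T}^n$ is the product of the counting measure $\nu$ on $\mathbb{Z}^n$ and the Lebesgue measure $\mu$ on $\mathbb{T}^n$ (total mass $1$). *)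

theory Defs
  imports "HOL-Analysis.Analysis"
begin

quotient_type (overloaded) 'n torus =
  "real ^ 'n::finite" / "\<lambda>x y :: real ^ 'n. \<forall>i. x $ i - y $ i \<in> \<int>"
  morphisms rep_torus to_torus
proof (rule equivpI)
  show "reflp (\<lambda>x y :: real ^ 'n. \<forall>i. x $ i - y $ i \<in> \<int>)"
    by (simp add: reflp_def)
  show "symp (\<lambda>x y :: real ^ 'n. \<forall>i. x $ i - y $ i \<in> \<int>)"
    unfolding symp_def by (metis Ints_minus minus_diff_eq)
  show "transp (\<lambda>x y :: real ^ 'n. \<forall>i. x $ i - y $ i \<in> \<int>)"
    unfolding transp_def by (metis Ints_add diff_add_cancel add_diff_eq)
qed

definition fundamental_cube :: "(real ^ 'n) set" where
  "fundamental_cube = {x. \<forall>i. 0 \<le> x $ i \<and> x $ i < 1}"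

text \<open>A set of cosets is measurable iff its preimage in Euclidean space is Lebesgue measurable.\<close>

definition torus_measure :: "('n::finite) torus measure" where
  "torus_measure =
     distr (lebesgue_on fundamental_cube)
       (sigma UNIV {A. to_torus -` A \<in> sets lebesgue}) to_torus"

lift_definition torus_char :: "int ^ 'n \<Rightarrow> ('n::finite) torus \<Rightarrow> complex"
  is "\<lambda>k w. exp (- 2 * of_real pi * \<i> * of_real (\<Sum>i\<in>UNIV. w $ i * of_int (k $ i)))"
proof -
  fix k :: "int ^ 'n" and v w :: "real ^ 'n"
  assume vw: "\<And>i. v $ i - w $ i \<in> \<int>"
  have "(\<Sum>i\<in>UNIV. (v $ i - w $ i) * of_int (k $ i)) \<in> \<int>"
    using vw by (intro Ints_sum Ints_mult) auto
  then obtain z :: int where z: "(\<Sum>i\<in>UNIV. (v $ i - w $ i) * of_int (k $ i)) = of_int z"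
    by (auto elim: Ints_cases)
  have eq: "(\<Sum>i\<in>UNIV. v $ i * of_int (k $ i)) =
      (\<Sum>i\<in>UNIV. w $ i * of_int (k $ i)) + real_of_int z"
    unfolding z[symmetric] by (simp add: sum.distrib[symmetric] algebra_simps)
  show "exp (- 2 * of_real pi * \<i> * of_real (\<Sum>i\<in>UNIV. v $ i * of_int (k $ i))) =
      exp (- 2 * of_real pi * \<i> * of_real (\<Sum>i\<in>UNIV. w $ i * of_int (k $ i)))"
    unfolding eq exp_eq by (intro exI[of _ "- z"]) (simp add: algebra_simps)
qed

definition ell2 :: "('a \<Rightarrow> complex) set" where
  "ell2 = {f. (\<lambda>k. (cmod (f k))\<^sup>2) summable_on UNIV}"

definition ell2_norm :: "('a \<Rightarrow> complex) \<Rightarrow> real" where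
  "ell2_norm f = sqrt (\<Sum>\<^sub>\<infinity>k. (cmod (f k))\<^sup>2)"

definition stft ::
  "(int ^ 'n \<Rightarrow> complex) \<Rightarrow> (int ^ 'n \<Rightarrow> complex) \<Rightarrow> int ^ 'n \<Rightarrow> ('n::finite) torus \<Rightarrow> complex" where
  "stft g f m w = (\<Sum>\<^sub>\<infinity>k. f k * cnj (g (k - m)) * torus_char k w)"

lemma space_torus_measure [simp]: "space torus_measure = UNIV"
  by (simp add: torus_measure_def)

lemma sets_torus_measure:
  "sets torus_measure = {A :: ('n::finite) torus set. to_torus -` A \<in> sets lebesgue}"
proof -
  have "sigma_algebra UNIV {A :: 'n torus set. to_torus -` A \<in> sets lebesgue}"
    unfolding sigma_algebra_iff2
  proof (intro conjI ballI allI impI)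
    fix A :: "'n torus set" assume "A \<in> {A. to_torus -` A \<in> sets lebesgue}"
    then show "UNIV - A \<in> {A. to_torus -` A \<in> sets lebesgue}"
      using sets.compl_sets[of "to_torus -` A" lebesgue] by (simp add: vimage_Diff)
  next
    fix A :: "nat \<Rightarrow> 'n torus set" assume "range A \<subseteq> {A. to_torus -` A \<in> sets lebesgue}"
    then have "(\<Union>i. to_torus -` A i) \<in> sets lebesgue"
      by (intro sets.countable_UN) auto
    then show "(\<Union>i. A i) \<in> {A. to_torus -` A \<in> sets lebesgue}"
      by (simp add: vimage_UN)
  qed auto
  then show ?thesis
    by (simp add: torus_measure_def sigma_algebra.sigma_sets_eq)
qed

lemma fundamental_cube_lebesgue [simp]:
  "(fundamental_cube :: (real ^ 'n) set) \<in> sets lebesgue"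
proof -
  have "fundamental_cube = (\<Inter>i. {x :: real ^ 'n. 0 \<le> x $ i} \<inter> {x. x $ i < 1})"
    by (auto simp: fundamental_cube_def)
  also have "\<dots> \<in> sets borel"
    by (intro sets.countable_INT' sets.Int borel_closed borel_open
         closed_Collect_le open_Collect_less continuous_intros) auto
  finally show ?thesis by auto
qed

lemma emeasure_torus_measure:
  assumes "A \<in> sets torus_measure"
  shows "emeasure torus_measure A = emeasure lebesgue (to_torus -` A \<inter> fundamental_cube)"
proof -
  let ?S = "sigma UNIV {A :: 'a torus set. to_torus -` A \<in> sets lebesgue}"
  have sets: "sets ?S = {A. to_torus -` A \<in> sets lebesgue}"
    using sets_torus_measure by (simp add: torus_measure_def)
  have "to_torus \<in> measurable (lebesgue_on fundamental_cube) ?S"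
    unfolding measurable_def sets
    by (auto simp: sets_restrict_space Int_commute)
  then show ?thesis
    using assms sets unfolding torus_measure_def
    by (subst emeasure_distr) (auto simp: emeasure_restrict_space)
qed

lemma emeasure_torus_measure_UNIV:
  "emeasure torus_measure (UNIV :: ('n::finite) torus set) = 1"
proof -
  have sub: "box 0 1 \<subseteq> (fundamental_cube :: (real ^ 'n) set)"
            "fundamental_cube \<subseteq> cbox 0 (1 :: real ^ 'n)"
    by (auto simp: fundamental_cube_def mem_box_cart less_imp_le)
  have "emeasure lebesgue (box 0 (1 :: real ^ 'n)) = 1"
       "emeasure lebesgue (cbox 0 (1 :: real ^ 'n)) = 1"
    by (simp_all add: emeasure_lborel_box_eq emeasure_lborel_cbox_eq Basis_vec_def
         inner_axis prod.UNION_disjoint prod.neutral)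
  moreover have "emeasure lebesgue (box 0 (1 :: real ^ 'n)) \<le> emeasure lebesgue (fundamental_cube :: (real ^ 'n) set)"
    by (rule emeasure_mono[OF sub(1) fundamental_cube_lebesgue])
  moreover have "emeasure lebesgue (fundamental_cube :: (real ^ 'n) set) \<le> emeasure lebesgue (cbox 0 (1 :: real ^ 'n))"
    by (rule emeasure_mono[OF sub(2)]) simp
  ultimately have "emeasure lebesgue (fundamental_cube :: (real ^ 'n) set) = 1"
    by simp
  then show ?thesis
    by (subst emeasure_torus_measure) (auto simp: sets_torus_measure)
qed

end

theory Submission
  imports Defs
begin

text \<open>The transform is bounded pointwise: characters are unimodular and translating the window
  preserves its norm, so Cauchy-Schwarz gives |V_g f(m,w)| \<le> ||f|| ||g|| everywhere
  (\<open>norm_stft_le\<close>). Integrating the square over Z x T yields at most ||f||^2 ||g||^2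
  times the measure of Z x T (\<open>infsum_const_ennreal\<close>,
  \<open>emeasure_count_space_Times_torus\<close>). As f and g are non-zero, the factor ||f||^2
  ||g||^2 is positive (\<open>ell2_norm_pos\<close>) and cancels against the same factor in the
  assumed lower bound.\<close>

lemma norm_torus_char [simp]: "cmod (torus_char k w) = 1"
  by transfer (simp add: norm_exp_eq_Re)

text \<open>Finite Cauchy-Schwarz, with each partial sum of squares enlarged to the full sum. The
  bound is uniform in \<open>F\<close>, which is what makes the product series absolutely summable
  in the next lemma.\<close>

lemma sum_norm_mult_le_sqrt_infsum:
  fixes f g :: "'a \<Rightarrow> 'b::real_normed_div_algebra"
  assumes f: "(\<lambda>k. (norm (f k))\<^sup>2) summable_on UNIV"
    and g: "(\<lambda>k. (norm (g k))\<^sup>2) summable_on UNIV" and F: "finite F"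
  shows "(\<Sum>k\<in>F. norm (f k * g k)) \<le>
    sqrt (\<Sum>\<^sub>\<infinity>k. (norm (f k))\<^sup>2) * sqrt (\<Sum>\<^sub>\<infinity>k. (norm (g k))\<^sup>2)"
proof -
  have le: "L2_set (\<lambda>k. norm (h k)) F \<le> sqrt (\<Sum>\<^sub>\<infinity>k. (norm (h k))\<^sup>2)"
    if "(\<lambda>k. (norm (h k))\<^sup>2) summable_on UNIV" for h :: "'a \<Rightarrow> 'b"
    unfolding L2_set_def using that F
    by (intro real_sqrt_le_mono finite_sum_le_infsum) auto
  have "(\<Sum>k\<in>F. norm (f k * g k)) = (\<Sum>k\<in>F. \<bar>norm (f k)\<bar> * \<bar>norm (g k)\<bar>)"
    by (simp add: norm_mult)
  also have "\<dots> \<le> L2_set (\<lambda>k. norm (f k)) F * L2_set (\<lambda>k. norm (g k)) F"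
    by (rule L2_set_mult_ineq)
  also have "\<dots> \<le> sqrt (\<Sum>\<^sub>\<infinity>k. (norm (f k))\<^sup>2) * sqrt (\<Sum>\<^sub>\<infinity>k. (norm (g k))\<^sup>2)"
    using le[OF f] le[OF g]
    by (intro mult_mono) (auto intro!: infsum_nonneg simp: L2_set_nonneg)
  finally show ?thesis .
qed

lemma norm_infsum_mult_le_sqrt_infsum:
  fixes f g :: "'a \<Rightarrow> 'b::{real_normed_div_algebra, banach}"
  assumes f: "(\<lambda>k. (norm (f k))\<^sup>2) summable_on UNIV"
    and g: "(\<lambda>k. (norm (g k))\<^sup>2) summable_on UNIV"
  shows "norm (\<Sum>\<^sub>\<infinity>k. f k * g k) \<le>
    sqrt (\<Sum>\<^sub>\<infinity>k. (norm (f k))\<^sup>2) * sqrt (\<Sum>\<^sub>\<infinity>k. (norm (g k))\<^sup>2)"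
proof -
  note bound = sum_norm_mult_le_sqrt_infsum[OF f g]
  have abs: "(\<lambda>k. norm (f k * g k)) summable_on UNIV"
    by (rule nonneg_bdd_above_summable_on) (auto intro!: bdd_aboveI2 bound)
  have "norm (\<Sum>\<^sub>\<infinity>k. f k * g k) \<le> (\<Sum>\<^sub>\<infinity>k. norm (f k * g k))"
    using abs by (rule norm_infsum_bound)
  also have "\<dots> \<le> sqrt (\<Sum>\<^sub>\<infinity>k. (norm (f k))\<^sup>2) * sqrt (\<Sum>\<^sub>\<infinity>k. (norm (g k))\<^sup>2)"
    using abs bound by (rule infsum_le_finite_sums)
  finally show ?thesis .
qed

lemma norm_stft_le:
  assumes f: "f \<in> ell2" and g: "g \<in> ell2"
  shows "cmod (stft g f m w) \<le> ell2_norm f * ell2_norm g"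
proof -
  \<comment> \<open>Conjugation and the character are absorbed into the second Cauchy-Schwarz
    factor; its modulus is that of a translate of \<open>g\<close>, so reindexing by the shift
    recovers the norm of \<open>g\<close>.\<close>
  let ?h = "\<lambda>k. cnj (g (k - m)) * torus_char k w"
  have norm_h: "(cmod (?h k))\<^sup>2 = (cmod (g (k - m)))\<^sup>2" for k
    by (simp add: norm_mult)
  have bij: "bij (\<lambda>k. k - m)"
    by (rule bij_betwI[where g = "\<lambda>k. k + m"]) auto
  have "(\<lambda>k. (cmod (?h k))\<^sup>2) summable_on UNIV"
    using g summable_on_reindex_bij_betw[OF bij, of "\<lambda>k. (cmod (g k))\<^sup>2"]
    unfolding norm_h ell2_def by simp
  moreover have "sqrt (\<Sum>\<^sub>\<infinity>k. (cmod (?h k))\<^sup>2) = ell2_norm g"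
    using infsum_reindex_bij_betw[OF bij, of "\<lambda>k. (cmod (g k))\<^sup>2"]
    unfolding norm_h ell2_norm_def by simp
  ultimately show ?thesis
    using norm_infsum_mult_le_sqrt_infsum[of f ?h] f
    by (simp add: stft_def ell2_norm_def[of f] ell2_def mult.assoc)
qed

lemma ell2_norm_pos:
  assumes "f \<in> ell2" and "f \<noteq> (\<lambda>_. 0)"
  shows "0 < ell2_norm f"
proof -
  obtain k where "f k \<noteq> 0" using assms(2) by auto
  then have "0 < (\<Sum>k\<in>{k}. (cmod (f k))\<^sup>2)" by simp
  also have "\<dots> \<le> (\<Sum>\<^sub>\<infinity>k. (cmod (f k))\<^sup>2)"
    using assms(1) by (intro finite_sum_le_infsum) (auto simp: ell2_def)
  finally show ?thesis by (simp add: ell2_norm_def)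
qed

text \<open>This lets \<open>Z\<close> be infinite: a positive constant then sums to \<infinity>,
  while for c = 0 the convention 0 * \<infinity> = 0 gives the right value.\<close>

lemma infsum_const_ennreal:
  "(\<Sum>\<^sub>\<infinity>x\<in>A. c :: ennreal) = c * emeasure (count_space UNIV) A"
proof (cases "finite A \<or> c = 0")
  case True
  then show ?thesis by (auto simp: mult.commute)
next
  case False
  then have "(\<Sum>\<^sub>\<infinity>x\<in>A. c) = \<infinity>"
    by (intro infsum_superconst_infinite_ennreal[where b = c]) (auto simp: zero_less_iff_neq_zero)
  with False show ?thesis by (simp add: ennreal_mult_top)
qed

text \<open>The product formula rests on sigma-finiteness of the second factor, which follows from
  the total mass 1 of the torus.\<close>

lemma emeasure_count_space_Times_torus:
  assumes "T \<in> sets torus_measure"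
  shows "emeasure (count_space UNIV \<Otimes>\<^sub>M torus_measure) (Z \<times> T) =
    emeasure (count_space UNIV) Z * emeasure torus_measure T"
proof -
  interpret finite_measure torus_measure
    by (rule finite_measureI) (simp add: emeasure_torus_measure_UNIV)
  show ?thesis using assms by (intro emeasure_pair_measure_Times) auto
qed

theorem theorem3p3:
  fixes f g :: "int ^ 'n \<Rightarrow> complex"
    and Z :: "(int ^ 'n) set"
    and T :: "'n torus set"
    and \<epsilon> :: real
  assumes "f \<in> ell2" and "f \<noteq> (\<lambda>_. 0)"
    and "g \<in> ell2" and "g \<noteq> (\<lambda>_. 0)"
    and "T \<in> sets torus_measure"
    and "\<epsilon> \<ge> 0"
    and "(\<Sum>\<^sub>\<infinity>m\<in>Z. \<integral>\<^sup>+w\<in>T. ennreal ((cmod (stft g f m w))\<^sup>2) \<partial>torus_measure)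
           \<ge> ennreal ((1 - \<epsilon>) * (ell2_norm f)\<^sup>2 * (ell2_norm g)\<^sup>2)"
  shows "emeasure (count_space UNIV \<Otimes>\<^sub>M torus_measure) (Z \<times> T) \<ge> ennreal (1 - \<epsilon>)"
proof -
  define C where "C = (ell2_norm f * ell2_norm g)\<^sup>2"
  have C: "C > 0"
    using ell2_norm_pos[OF assms(1,2)] ell2_norm_pos[OF assms(3,4)] by (simp add: C_def)
  \<comment> \<open>The sign of 1 - \<epsilon> is irrelevant: since C > 0, for \<epsilon> > 1
    \<open>ennreal\<close> truncates both sides to 0.\<close>
  have "ennreal C * ennreal (1 - \<epsilon>) = ennreal ((1 - \<epsilon>) * (ell2_norm f)\<^sup>2 * (ell2_norm g)\<^sup>2)"
    using C by (subst ennreal_mult'[symmetric]) (auto simp: C_def power_mult_distrib mult_ac)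
  also have "\<dots> \<le> (\<Sum>\<^sub>\<infinity>m\<in>Z. \<integral>\<^sup>+w\<in>T. ennreal ((cmod (stft g f m w))\<^sup>2) \<partial>torus_measure)"
    by (rule assms(7))
  \<comment> \<open>The pointwise bound, squared, passes through the integral and the sum, because
    every sum in \<open>ennreal\<close> exists.\<close>
  also have "\<dots> \<le> (\<Sum>\<^sub>\<infinity>m\<in>Z. \<integral>\<^sup>+w\<in>T. ennreal C \<partial>torus_measure)"
    using norm_stft_le[OF assms(1,3)] unfolding C_def
    by (intro infsum_mono nn_integral_mono mult_right_mono ennreal_leI power_mono
        nonneg_summable_on_complete) auto
  also have "\<dots> = ennreal C * emeasure torus_measure T * emeasure (count_space UNIV) Z"
    using assms(5) by (simp add: infsum_const_ennreal nn_integral_cmult_indicator)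
  also have "\<dots> = ennreal C * emeasure (count_space UNIV \<Otimes>\<^sub>M torus_measure) (Z \<times> T)"
    using assms(5) by (simp add: emeasure_count_space_Times_torus mult_ac)
  \<comment> \<open>\<open>ennreal C\<close> is neither 0 nor \<infinity>, so it cancels.\<close>
  finally show ?thesis
    using C by (simp add: ennreal_mult_le_mult_iff)
qed

end
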